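(* The non-equivariance two-cocycle $\Sigma$ of the momentum map of the diagonal $SE(2)$-action on $T^*SE(2)\times\mathbb{R}^{2N}$ with symplectic form $\Omega_{\mathrm{can}}-\beta_\mu$ is given by $$\Sigma=-\Gamma\,\mathbf{e}_x^*\wedge\mathbf{e}_y^*,$$ where $\Gamma=\sum_{i=1}^N\Gamma_i$ is the total vortex strength.
   Context: $SE(2)$ consists of $g=(R_\beta,\mathbf{x}_0)$, $\mathbf{x}_0=(x_0,y_0)$, acting on $\mathbb{R}^2$ by $\mathbf{x}\mapsto R_\beta\mathbf{x}+\mathbf{x}_0$ ($R_\beta$ the rotation by $\beta$), and acts diagonally from the left on $SE(2)\times\mathbb{R}^{2N}$ by $h\cdot(g;\mathbf{x}_1,\dots,\mathbf{x}_N)=(hg;h\mathbf{x}_1,\dots,h\mathbf{x}_N)$, and on $T^*SE(2)\times\mathbb{R}^{2N}$ using the cotangent lift in the first factor. The $\mathbf{x}_i$ are restricted to lie outside the disc of radius $R$ centred at $\mathbf{x}_0$. The basis $\mathbf{e}_\Omega,\mathbf{e}_x,\mathbf{e}_y$ of $\mathfrak{se}(2)$ generates on $\mathbb{R}^2$ the vector fields $-y\partial_x+x\partial_y$, $\partial_x$, $\partial_y$ respectively; in $3\times3$ matrix form $[\mathbf{e}_\Omega,\mathbf{e}_x]=\mathbf{e}_y$, $[\mathbf{e}_\Omega,\mathbf{e}_y]=-\mathbf{e}_x$, $[\mathbf{e}_x,\mathbf{e}_y]=0$. The dual basis is $\mathbf{e}_\Omega^*,\mathbf{e}_x^*,\mathbf{e}_y^*$,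 and $(\mathbf{e}_x^*\wedge\mathbf{e}_y^* )(\mathbf{e}_x,\mathbf{e}_y)=1$. With vortex strengths $\Gamma_1,\dots,\Gamma_N\in\mathbb{R}$, $\beta_\mu$ is the closed two-form on $SE(2)\times\mathbb{R}^{2N}$ $$\beta_\mu=\sum_{i=1}^N\Gamma_i\big(-dx_i\wedge dy_i-\mathbf{d}\Theta_i\big),\qquad \Theta_i=\Psi'_x(g,\mathbf{x}_i)\,dx_0+\Psi'_y(g,\mathbf{x}_i)\,dy_0,$$ $$\Psi'_x=R^2\frac{y-y_0}{(x-x_0)^2+(y-y_0)^2},\qquad\Psi'_y=-R^2\frac{x-x_0}{(x-x_0)^2+(y-y_0)^2}.$$ The momentum map is $J=J_{\mathrm{can}}-\phi$, where $J_{\mathrm{can}}$ is the momentum map of the cotangent-lifted left action for $\Omega_{\mathrm{can}}$ and $\phi:SE(2)\times\mathbb{R}^{2N}\to\mathfrak{se}(2)^*$ satisfies $\mathbf{i}_{\xi_{SE(2)\times\mathbb{R}^{2N}}}\beta_\mu=\mathbf{d}\langle\phi,\xi\rangle$; explicitly $\phi=\phi_{\mathrm{vortex}}+\phi_{\mathrm{stream}}$ with $$(\phi_{\mathrm{vortex}}^x,\phi_{\mathrm{vortex}}^y)=-\sum_i\Gamma_i\,\mathbf{x}_i\times\mathbf{e}_3=\sum_i\Gamma_i(-y_i,x_i),\quad\phi_{\mathrm{vortex}}^\Omega=\sum_i\frac{\Gamma_i}{2}(x_i^2+y_i^2),\quad\langle\phi_{\mathrm{stream}},\xi\rangle=\sum_i\Gamma_i\,\mathbf{i}_{\xi_{SE(2)\times\mathbb{R}^{2N}}}\Theta_i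 .$$ The non-equivariance two-cocycle is the map $\Sigma:\mathfrak{se}(2)\times\mathfrak{se}(2)\to C^\infty(SE(2)\times\mathbb{R}^{2N})$, $$\Sigma(\xi,\eta)=-\langle\phi,[\xi,\eta]\rangle+\beta_\mu(\xi_{SE(2)\times\mathbb{R}^{2N}},\eta_{SE(2)\times\mathbb{R}^{2N}}),$$ where the subscript denotes infinitesimal generators of the diagonal action. *)

theory Defs
  imports "HOL-Analysis.Analysis"
begin

section \<open>The group SE(2) and its Lie algebra in homogeneous coordinates\<close>

text \<open>
  The pair $(R_\beta, \mathbf{x}_0)$ is encoded as the $3\times 3$ matrix with blocks
  $R_\beta$, $\mathbf{x}_0$ and last row $(0,0,1)$, so that the group product is the matrix product
  and the Lie bracket is the commutator.  On \<^typ>\<open>real^3^3\<close> the overloaded product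
  is componentwise; matrix multiplication is \<open>**\<close>.
\<close>

definition se2_elt :: "real \<Rightarrow> real^2 \<Rightarrow> real^3^3" where
  "se2_elt b c = vector [vector [cos b, - sin b, c $ 1],
                         vector [sin b,   cos b, c $ 2],
                         vector [0,       0,     1]]"

definition SE2 :: "(real^3^3) set" where
  "SE2 = {se2_elt b c | b c. True}"

definition rotation_part :: "real^3^3 \<Rightarrow> real^2^2" where
  "rotation_part g = vector [vector [g $ 1 $ 1, g $ 1 $ 2], vector [g $ 2 $ 1, g $ 2 $ 2]]"

definition translation_part :: "real^3^3 \<Rightarrow> real^2" where
  "translation_part g = vector [g $ 1 $ 3, g $ 2 $ 3]"

definition plane_act :: "real^3^3 \<Rightarrow> real^2 \<Rightarrow> real^2" where
  "plane_act g x = rotation_part g *v x + translation_part g"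

definition e_Omega :: "real^3^3" where
  "e_Omega = vector [vector [0, -1, 0], vector [1, 0, 0], vector [0, 0, 0]]"

definition e_x :: "real^3^3" where
  "e_x = vector [vector [0, 0, 1], vector [0, 0, 0], vector [0, 0, 0]]"

definition e_y :: "real^3^3" where
  "e_y = vector [vector [0, 0, 0], vector [0, 0, 1], vector [0, 0, 0]]"

definition se2 :: "(real^3^3) set" where
  "se2 = span {e_Omega, e_x, e_y}"

definition lie_bracket :: "real^3^3 \<Rightarrow> real^3^3 \<Rightarrow> real^3^3" where
  "lie_bracket \<xi> \<eta> = \<xi> ** \<eta> - \<eta> ** \<xi>"

text \<open>
  The dual basis: an element of \<^const>\<open>se2\<close> with coordinates $(\omega, a, b)$ has
  entry $\omega$ at position $(2,1)$, $a$ at $(1,3)$ and $b$ at $(2,3)$.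
\<close>

definition dual_Omega :: "real^3^3 \<Rightarrow> real" where
  "dual_Omega \<xi> = \<xi> $ 2 $ 1"

definition dual_x :: "real^3^3 \<Rightarrow> real" where
  "dual_x \<xi> = \<xi> $ 1 $ 3"

definition dual_y :: "real^3^3 \<Rightarrow> real" where
  "dual_y \<xi> = \<xi> $ 2 $ 3"

lemma dual_basis:
  "dual_Omega e_Omega = 1" "dual_Omega e_x = 0" "dual_Omega e_y = 0"
  "dual_x e_Omega = 0" "dual_x e_x = 1" "dual_x e_y = 0"
  "dual_y e_Omega = 0" "dual_y e_x = 0" "dual_y e_y = 1"
  by (simp_all add: dual_Omega_def dual_x_def dual_y_def e_Omega_def e_x_def e_y_def)

lemma lie_bracket_basis:
  "lie_bracket e_Omega e_x = e_y"
  "lie_bracket e_Omega e_y = - e_x"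
  "lie_bracket e_x e_y = 0"
  by (simp_all add: lie_bracket_def e_Omega_def e_x_def e_y_def matrix_matrix_mult_def
      vec_eq_iff forall_3 sum_3)

definition wedge :: "('v \<Rightarrow> real) \<Rightarrow> ('v \<Rightarrow> real) \<Rightarrow> 'v \<Rightarrow> 'v \<Rightarrow> real" where
  "wedge \<alpha> \<gamma> u v = \<alpha> u * \<gamma> v - \<alpha> v * \<gamma> u"

definition mat_exp :: "real^'n^'n \<Rightarrow> real^'n^'n" where
  "mat_exp A = (\<Sum>k. (1 / fact k) *\<^sub>R (((**) A ^^ k) (mat 1)))"


section \<open>The configuration space with N vortices and the diagonal action\<close>

text \<open>
  The finite index type \<open>'n\<close> numbers the vortices.  The configuration space is a submanifold of
  the vector space \<open>'n conf\<close>, so tangent vectors are elements of that same vector space.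
\<close>

type_synonym 'n conf = "(real^3^3) \<times> ((real^2)^'n)"

definition conf_space :: "real \<Rightarrow> 'n::finite conf set" where
  "conf_space R = {(g, X). g \<in> SE2 \<and> (\<forall>i. norm (X $ i - translation_part g) > R)}"

definition diag_act :: "real^3^3 \<Rightarrow> 'n::finite conf \<Rightarrow> 'n conf" where
  "diag_act h p = (h ** fst p, \<chi> i. plane_act h (snd p $ i))"

definition inf_generator :: "real^3^3 \<Rightarrow> 'n::finite conf \<Rightarrow> 'n conf" where
  "inf_generator \<xi> p = vector_derivative (\<lambda>t. diag_act (mat_exp (t *\<^sub>R \<xi>)) p) (at 0)"


section \<open>The two-form, the map phi and the cocycle\<close>

text \<open>
  A one-form assigns to a point and a tangent vector a real number.  The coordinate differentials
  $dx_0$, $dy_0$, $dx_i$, $dy_i$ are constant linear functionals on the ambient vector space.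
\<close>

definition d_x0 :: "'n::finite conf \<Rightarrow> real" where
  "d_x0 u = translation_part (fst u) $ 1"

definition d_y0 :: "'n::finite conf \<Rightarrow> real" where
  "d_y0 u = translation_part (fst u) $ 2"

definition d_x :: "'n::finite \<Rightarrow> 'n conf \<Rightarrow> real" where
  "d_x i u = snd u $ i $ 1"

definition d_y :: "'n::finite \<Rightarrow> 'n conf \<Rightarrow> real" where
  "d_y i u = snd u $ i $ 2"

text \<open>
  $\mathbf{d}\omega(u,v) = D_u(\omega(v)) - D_v(\omega(u))$ for constant vector fields $u$, $v$.
  The one-forms below are defined near the configuration space in the ambient vector space, and
  $\mathbf{d}$ commutes with restriction to a submanifold; so on tangent vectors this is the
  exterior derivative of the restricted form.
\<close>

definition ext_deriv ::
    "('v::real_normed_vector \<Rightarrow> 'v \<Rightarrow> real) \<Rightarrow> 'v \<Rightarrow> 'v \<Rightarrow> 'v \<Rightarrow> real" where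
  "ext_deriv \<omega> p u v = frechet_derivative (\<lambda>q. \<omega> q v) (at p) u
                       - frechet_derivative (\<lambda>q. \<omega> q u) (at p) v"

definition Psi'_x :: "real \<Rightarrow> real^3^3 \<Rightarrow> real^2 \<Rightarrow> real" where
  "Psi'_x R g x = (let c = translation_part g
     in R\<^sup>2 * ((x $ 2 - c $ 2) / ((x $ 1 - c $ 1)\<^sup>2 + (x $ 2 - c $ 2)\<^sup>2)))"

definition Psi'_y :: "real \<Rightarrow> real^3^3 \<Rightarrow> real^2 \<Rightarrow> real" where
  "Psi'_y R g x = (let c = translation_part g
     in - (R\<^sup>2 * ((x $ 1 - c $ 1) / ((x $ 1 - c $ 1)\<^sup>2 + (x $ 2 - c $ 2)\<^sup>2))))"

definition Theta :: "real \<Rightarrow> 'n::finite \<Rightarrow> 'n conf \<Rightarrow> 'n conf \<Rightarrow> real" where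
  "Theta R i p u = Psi'_x R (fst p) (snd p $ i) * d_x0 u + Psi'_y R (fst p) (snd p $ i) * d_y0 u"

definition beta_mu ::
    "real \<Rightarrow> ('n::finite \<Rightarrow> real) \<Rightarrow> 'n conf \<Rightarrow> 'n conf \<Rightarrow> 'n conf \<Rightarrow> real" where
  "beta_mu R \<Gamma> p u v =
     (\<Sum>i\<in>UNIV. \<Gamma> i * (- wedge (d_x i) (d_y i) u v - ext_deriv (Theta R i) p u v))"

text \<open>
  The momentum map of the action on $T^*SE(2)\times\mathbb{R}^{2N}$ with symplectic form
  $\Omega_{\mathrm{can}} - \beta_\mu$ is $J_{\mathrm{can}} - \phi$.  Its non-equivariance is due
  to $\phi$ alone; \<open>phi p \<xi>\<close> is the pairing $\langle\phi(p),\xi\rangle$.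
\<close>

definition phi_vortex :: "('n::finite \<Rightarrow> real) \<Rightarrow> 'n conf \<Rightarrow> real^3^3 \<Rightarrow> real" where
  "phi_vortex \<Gamma> p \<xi> =
     (\<Sum>i\<in>UNIV. \<Gamma> i / 2 * ((snd p $ i $ 1)\<^sup>2 + (snd p $ i $ 2)\<^sup>2)) * dual_Omega \<xi>
   + (\<Sum>i\<in>UNIV. \<Gamma> i * (- (snd p $ i $ 2))) * dual_x \<xi>
   + (\<Sum>i\<in>UNIV. \<Gamma> i * snd p $ i $ 1) * dual_y \<xi>"

definition phi_stream ::
    "real \<Rightarrow> ('n::finite \<Rightarrow> real) \<Rightarrow> 'n conf \<Rightarrow> real^3^3 \<Rightarrow> real" where
  "phi_stream R \<Gamma> p \<xi> = (\<Sum>i\<in>UNIV. \<Gamma> i * Theta R i p (inf_generator \<xi> p))"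

definition phi :: "real \<Rightarrow> ('n::finite \<Rightarrow> real) \<Rightarrow> 'n conf \<Rightarrow> real^3^3 \<Rightarrow> real" where
  "phi R \<Gamma> p \<xi> = phi_vortex \<Gamma> p \<xi> + phi_stream R \<Gamma> p \<xi>"

definition Sigma_cocycle ::
    "real \<Rightarrow> ('n::finite \<Rightarrow> real) \<Rightarrow> real^3^3 \<Rightarrow> real^3^3 \<Rightarrow> 'n conf \<Rightarrow> real" where
  "Sigma_cocycle R \<Gamma> \<xi> \<eta> p =
     - phi R \<Gamma> p (lie_bracket \<xi> \<eta>)
     + beta_mu R \<Gamma> p (inf_generator \<xi> p) (inf_generator \<eta> p)"

end

theory Submission
  imports Defs
begin

text \<open>
  Both terms of the cocycle split over the vortices into a contribution of the area form
  $dx_i \wedge dy_i$ and one of the one-form $\Theta_i$, and only the former survives.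

  The coefficients of $\Theta_i$ depend only on the position of the vortex relative to the centre
  of the disc, and $\Theta_i$ is invariant under the diagonal action, so its Lie derivative along a
  generator vanishes.  Cartan's formula then yields
  $\mathbf{d}\Theta_i(\xi_M, \eta_M) = \Theta_i([\xi_M, \eta_M])$, and for a left action
  $[\xi_M, \eta_M] = -[\xi,\eta]_M$.  Hence the two stream contributions to $\Sigma$ cancel.
  This is \<open>ext_deriv_Theta_on_generators\<close>.  The proof there works in coordinates: a generator
  moves the relative position perpendicularly to itself, so the squared distance in the
  denominator of $\Theta_i$ does not change to first order, and only its linear numerator has
  to be differentiated.

  What is left is the non-equivariance of the momentum map of the plane with the area form
  $-\Gamma_i\, dx_i \wedge dy_i$.  The area spanned by two generators is an affine function of
  the position, since the velocities of two rotations about the origin are parallel.  Its linear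
  part is compensated by \<open>phi_vortex\<close> on the bracket, and its constant term is
  the area spanned by the two translation parts.  This is \<open>vortex_contribution\<close>.

  The generators themselves are computed without closed formulas for the exponential: the
  diagonal action extends to a map that is linear in the matrix, so its derivative along
  $\exp(t\xi)$ at $0$ is the same map applied to $\xi$.
\<close>

text \<open>
  The matrix-valued function is differentiated entry by entry, which brings in the theory of real
  power series: each entry of $\exp(tA)$ is an everywhere convergent power series in $t$, which may be
  differentiated term by term; at $0$ only the coefficient of $t$, an entry of $A$, remains.
\<close>
lemma mat_exp_has_vector_derivative_at_0:
  fixes A :: "real^'n^'n"
  shows "((\<lambda>t. mat_exp (t *\<^sub>R A)) has_vector_derivative A) (at 0)"
proof -
  define P :: "nat \<Rightarrow> real^'n^'n" where "P k = ((**) A ^^ k) (mat 1)" for k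
  have bl: "bounded_linear ((**) A :: real^'n^'n \<Rightarrow> real^'n^'n)"
    by (intro linear_conv_bounded_linear[THEN iffD1] linearI)
       (simp_all add: matrix_add_ldistrib matrix_scalar_ac scalar_matrix_assoc)
  define M where "M = onorm ((**) A :: real^'n^'n \<Rightarrow> real^'n^'n)"
  have M0: "M \<ge> 0" unfolding M_def by (rule onorm_pos_le[OF bl])
  have bound: "norm (P k) \<le> M ^ k * norm (mat 1 :: real^'n^'n)" for k
  proof (induction k)
    case (Suc k)
    have "norm (P (Suc k)) \<le> M * norm (P k)"
      using onorm[OF bl, of "P k"] by (simp add: P_def M_def)
    also have "\<dots> \<le> M * (M ^ k * norm (mat 1 :: real^'n^'n))"
      by (rule mult_left_mono[OF Suc M0])
    finally show ?case by (simp add: mult.assoc)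
  qed (simp add: P_def)
  have scaled: "((**) (t *\<^sub>R A) ^^ k) (mat 1) = t ^ k *\<^sub>R P k" for t k
    by (induction k) (simp_all add: P_def matrix_scalar_ac scalar_matrix_assoc mult.commute)
  have summ: "summable (\<lambda>k. (t ^ k / fact k) *\<^sub>R P k)" for t
  proof (rule summable_comparison_test')
    show "summable (\<lambda>k. (1 / fact k * (\<bar>t\<bar> * M) ^ k) * norm (mat 1 :: real^'n^'n))"
      using summable_exp[of "\<bar>t\<bar> * M"] by (intro summable_mult2) (simp add: field_simps)
    show "norm ((t ^ k / fact k) *\<^sub>R P k)
            \<le> (1 / fact k * (\<bar>t\<bar> * M) ^ k) * norm (mat 1 :: real^'n^'n)" if "k \<ge> 0" for k
      using mult_left_mono[OF bound[of k], of "\<bar>t\<bar> ^ k / fact k"]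
      by (simp add: power_abs power_mult_distrib field_simps)
  qed
  have entry: "((\<lambda>t. mat_exp (t *\<^sub>R A) $ i $ j) has_real_derivative A $ i $ j) (at 0)" for i j
  proof -
    define c where "c k = P k $ i $ j / fact k" for k
    have bl2: "bounded_linear (\<lambda>B :: real^'n^'n. B $ i $ j)"
      by (rule bounded_linear_compose[OF bounded_linear_vec_nth bounded_linear_vec_nth])
    have sc: "summable (\<lambda>k. c k * t ^ k)" for t
      using bounded_linear.summable[OF bl2 summ[of t]] by (simp add: c_def mult.commute)
    have "mat_exp (t *\<^sub>R A) $ i $ j = (\<Sum>k. c k * t ^ k)" for t
      using bounded_linear.suminf[OF bl2 summ[of t]]
      by (simp add: mat_exp_def scaled c_def mult.commute)
    moreover have "((\<lambda>t. \<Sum>k. c k * t ^ k) has_real_derivative (\<Sum>k. diffs c k * 0 ^ k)) (at 0)"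
      by (rule termdiffs_strong[OF sc[of 1]]) simp
    moreover have "(\<Sum>k. diffs c k * 0 ^ k) = A $ i $ j"
      by (subst powser_zero) (simp add: diffs_def c_def P_def)
    ultimately show ?thesis by (simp only:)
  qed
  show ?thesis
    unfolding has_vector_derivative_def
  proof (rule has_derivative_componentwise_within[THEN iffD2], rule ballI)
    fix b :: "real^'n^'n" assume "b \<in> Basis"
    then obtain i j where b: "b = axis i (axis j 1)"
      by (auto simp: Basis_vec_def)
    have pairing: "B \<bullet> b = B $ i $ j" for B :: "real^'n^'n"
      by (simp add: b inner_axis)
    have "(\<lambda>h. h *\<^sub>R A \<bullet> b) = (*) (A $ i $ j)"
      by (simp add: fun_eq_iff pairing)
    then show "((\<lambda>t. mat_exp (t *\<^sub>R A) \<bullet> b) has_derivative (\<lambda>h. h *\<^sub>R A \<bullet> b)) (at 0)"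
      using entry[of i j] by (simp only: pairing has_field_derivative_def)
  qed
qed

text \<open>
  The action formula makes sense for every matrix, invertible or not, and is linear in it:
  $h \mathbf{x}$ is the rotation part applied to $\mathbf{x}$ plus the translation part, and both
  parts consist of entries of $h$.
\<close>
lemma linear_diag_act: "linear (\<lambda>h. diag_act h p)"
  by (rule linearI)
     (simp_all add: diag_act_def plane_act_def rotation_part_def translation_part_def
        vec_eq_iff forall_2 forall_3 matrix_vector_mult_def matrix_matrix_mult_def sum_2 sum_3 algebra_simps)

lemma inf_generator_eq_diag_act: "inf_generator \<xi> p = diag_act \<xi> p"
proof -
  have "((\<lambda>t. diag_act (mat_exp (t *\<^sub>R \<xi>)) p) has_vector_derivative diag_act \<xi> p) (at 0)"
    by (rule bounded_linear.has_vector_derivative[OF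
          linear_diag_act[unfolded linear_conv_bounded_linear] mat_exp_has_vector_derivative_at_0])
  then show ?thesis
    unfolding inf_generator_def by (rule vector_derivative_at)
qed

lemma se2_entries:
  assumes "\<xi> \<in> se2"
  shows "\<xi> $ 1 $ 1 = 0" "\<xi> $ 1 $ 2 = - dual_Omega \<xi>" "\<xi> $ 1 $ 3 = dual_x \<xi>"
        "\<xi> $ 2 $ 1 = dual_Omega \<xi>" "\<xi> $ 2 $ 2 = 0" "\<xi> $ 2 $ 3 = dual_y \<xi>"
        "\<xi> $ 3 $ j = 0"
proof -
  obtain a b c where "\<xi> = a *\<^sub>R e_Omega + b *\<^sub>R e_x + c *\<^sub>R e_y"
    using assms unfolding se2_def span_insert span_singleton span_empty
    by (auto simp: algebra_simps)
  then show "\<xi> $ 1 $ 1 = 0" "\<xi> $ 1 $ 2 = - dual_Omega \<xi>" "\<xi> $ 1 $ 3 = dual_x \<xi>"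
        "\<xi> $ 2 $ 1 = dual_Omega \<xi>" "\<xi> $ 2 $ 2 = 0" "\<xi> $ 2 $ 3 = dual_y \<xi>"
        "\<xi> $ 3 $ j = 0"
    using exhaust_3[of j]
    by (auto simp: e_Omega_def e_x_def e_y_def dual_Omega_def dual_x_def dual_y_def)
qed

lemma dual_lie_bracket:
  assumes "\<xi> \<in> se2" "\<eta> \<in> se2"
  shows "dual_Omega (lie_bracket \<xi> \<eta>) = 0"
    "dual_x (lie_bracket \<xi> \<eta>) = dual_y \<xi> * dual_Omega \<eta> - dual_Omega \<xi> * dual_y \<eta>"
    "dual_y (lie_bracket \<xi> \<eta>) = dual_Omega \<xi> * dual_x \<eta> - dual_x \<xi> * dual_Omega \<eta>"
  unfolding dual_Omega_def[of "lie_bracket _ _"] dual_x_def[of "lie_bracket _ _"] dual_y_def[of "lie_bracket _ _"]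
  by (simp_all add: lie_bracket_def matrix_matrix_mult_def sum_3 se2_entries[OF assms(1)] se2_entries[OF assms(2)])

lemma lie_bracket_in_se2:
  assumes "\<xi> \<in> se2" "\<eta> \<in> se2"
  shows "lie_bracket \<xi> \<eta> \<in> se2"
proof -
  have "lie_bracket \<xi> \<eta> = dual_x (lie_bracket \<xi> \<eta>) *\<^sub>R e_x + dual_y (lie_bracket \<xi> \<eta>) *\<^sub>R e_y"
    unfolding dual_lie_bracket[OF assms]
    by (simp add: e_x_def e_y_def lie_bracket_def vec_eq_iff forall_3
        matrix_matrix_mult_def sum_3 se2_entries[OF assms(1)] se2_entries[OF assms(2)])
  also have "\<dots> \<in> se2"
    unfolding se2_def by (intro span_add span_scale span_base) simp_all
  finally show ?thesis .
qed

lemma generator_coordinates: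
  assumes "\<xi> \<in> se2" "fst p \<in> SE2"
  shows "d_x0 (inf_generator \<xi> p) = dual_x \<xi> - dual_Omega \<xi> * d_y0 p"
    "d_y0 (inf_generator \<xi> p) = dual_y \<xi> + dual_Omega \<xi> * d_x0 p"
    "d_x i (inf_generator \<xi> p) = dual_x \<xi> - dual_Omega \<xi> * d_y i p"
    "d_y i (inf_generator \<xi> p) = dual_y \<xi> + dual_Omega \<xi> * d_x i p"
  using assms(2)
  by (auto simp: inf_generator_eq_diag_act diag_act_def plane_act_def rotation_part_def
      translation_part_def d_x0_def d_y0_def d_x_def d_y_def SE2_def se2_elt_def
      matrix_vector_mult_def matrix_matrix_mult_def sum_2 sum_3 se2_entries[OF assms(1)])

text \<open>
  The position of a vortex relative to the centre of the disc.  The same linear functional also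
  takes a tangent vector to the relative velocity.
\<close>
definition rel_x :: "'n::finite \<Rightarrow> 'n conf \<Rightarrow> real" where
  "rel_x i u = d_x i u - d_x0 u"

definition rel_y :: "'n::finite \<Rightarrow> 'n conf \<Rightarrow> real" where
  "rel_y i u = d_y i u - d_y0 u"

lemma bounded_linear_rel: "bounded_linear (rel_x i)" "bounded_linear (rel_y i)"
  unfolding linear_conv_bounded_linear[symmetric]
  by (rule linearI; simp add: rel_x_def rel_y_def d_x_def d_y_def d_x0_def d_y0_def
      translation_part_def algebra_simps)+

text \<open>
  Up to the factor $R^2$, the stream form is the angle form of the relative position with the
  relative velocity replaced by minus the velocity of the centre.
\<close>
lemma Theta_relative:
  "Theta R i p u = R\<^sup>2 * (rel_y i p * d_x0 u - rel_x i p * d_y0 u) / ((rel_x i p)\<^sup>2 + (rel_y i p)\<^sup>2)"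
  by (simp add: Theta_def Psi'_x_def Psi'_y_def Let_def rel_x_def rel_y_def d_x_def d_y_def
      d_x0_def d_y0_def algebra_simps diff_divide_distrib add_divide_distrib)

text \<open>
  In a direction perpendicular to the relative position the derivative of the denominator of
  $\Theta_i$ vanishes, which leaves the derivative of the numerator.  Generators of the action are
  such directions.
\<close>
lemma frechet_derivative_Theta_perpendicular:
  fixes p :: "'n::finite conf"
  assumes nz: "(rel_x i p)\<^sup>2 + (rel_y i p)\<^sup>2 \<noteq> 0"
    and orth: "rel_x i p * rel_x i u + rel_y i p * rel_y i u = 0"
  shows "frechet_derivative (\<lambda>q. Theta R i q v) (at p) u =
      R\<^sup>2 * (rel_y i u * d_x0 v - rel_x i u * d_y0 v) / ((rel_x i p)\<^sup>2 + (rel_y i p)\<^sup>2)"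
proof -
  \<comment> \<open>The quotient rule, with the factor that \<open>orth\<close> annihilates kept in one piece.\<close>
  define D where "D = (\<lambda>u. (R\<^sup>2 * (rel_y i u * d_x0 v - rel_x i u * d_y0 v) *
       ((rel_x i p)\<^sup>2 + (rel_y i p)\<^sup>2) - R\<^sup>2 * (rel_y i p * d_x0 v - rel_x i p * d_y0 v) *
        (2 * (rel_x i p * rel_x i u + rel_y i p * rel_y i u))) /
       ((rel_x i p)\<^sup>2 + (rel_y i p)\<^sup>2)\<^sup>2)"
  note [derivative_intros] = bounded_linear_rel[THEN bounded_linear_imp_has_derivative]
  have "((\<lambda>q. Theta R i q v) has_derivative D) (at p)"
    unfolding Theta_relative
    by (rule derivative_eq_intros nz refl | simp)+
       (auto simp: D_def fun_eq_iff power2_eq_square algebra_simps)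
  then have "frechet_derivative (\<lambda>q. Theta R i q v) (at p) = D"
    by (rule frechet_derivative_at[symmetric])
  moreover have "D u = R\<^sup>2 * (rel_y i u * d_x0 v - rel_x i u * d_y0 v) *
      ((rel_x i p)\<^sup>2 + (rel_y i p)\<^sup>2) / ((rel_x i p)\<^sup>2 + (rel_y i p)\<^sup>2)\<^sup>2"
    unfolding D_def orth by simp
  ultimately show ?thesis
    using nz by (simp add: power2_eq_square[of "(rel_x i p)\<^sup>2 + (rel_y i p)\<^sup>2"]
        del: sum_power2_eq_zero_iff)
qed

lemma conf_space_relative_nonzero:
  assumes "R > 0" "p \<in> conf_space R"
  shows "(rel_x i p)\<^sup>2 + (rel_y i p)\<^sup>2 \<noteq> 0"
proof
  assume "(rel_x i p)\<^sup>2 + (rel_y i p)\<^sup>2 = 0"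
  then have "snd p $ i = translation_part (fst p)"
    by (simp add: rel_x_def rel_y_def d_x_def d_y_def d_x0_def d_y0_def vec_eq_iff forall_2)
  moreover have "norm (snd p $ i - translation_part (fst p)) > R"
    using assms(2) by (auto simp: conf_space_def)
  ultimately show False using assms(1) by simp
qed

text \<open>
  The coordinate form of $\mathbf{d}\Theta_i(\xi_M,\eta_M) = -\Theta_i([\xi,\eta]_M)$, which
  expresses the invariance of $\Theta_i$.
\<close>
lemma ext_deriv_Theta_on_generators:
  assumes "R > 0" "p \<in> conf_space R" "\<xi> \<in> se2" "\<eta> \<in> se2"
  shows "ext_deriv (Theta R i) p (inf_generator \<xi> p) (inf_generator \<eta> p)
       = - Theta R i p (inf_generator (lie_bracket \<xi> \<eta>) p)"
proof -
  have g: "fst p \<in> SE2" using assms(2) by (auto simp: conf_space_def)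
  note nz = conf_space_relative_nonzero[OF assms(1,2), of i]
  \<comment> \<open>The translation components act equally on vortex and centre, so the relative position only
     rotates.\<close>
  have rel: "rel_x i (inf_generator \<zeta> p) = - dual_Omega \<zeta> * rel_y i p"
            "rel_y i (inf_generator \<zeta> p) = dual_Omega \<zeta> * rel_x i p" if "\<zeta> \<in> se2" for \<zeta>
    by (simp_all add: rel_x_def rel_y_def generator_coordinates[OF that g] algebra_simps)
  have deriv: "frechet_derivative (\<lambda>q. Theta R i q v) (at p) (inf_generator \<zeta> p) =
      R\<^sup>2 * dual_Omega \<zeta> * (rel_x i p * d_x0 v + rel_y i p * d_y0 v) /
        ((rel_x i p)\<^sup>2 + (rel_y i p)\<^sup>2)" if "\<zeta> \<in> se2" for \<zeta> v
    by (subst frechet_derivative_Theta_perpendicular[OF nz]) (simp_all add: rel[OF that] algebra_simps)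
  show ?thesis
    unfolding ext_deriv_def deriv[OF assms(3)] deriv[OF assms(4)]
    unfolding Theta_relative
      generator_coordinates[OF assms(3) g] generator_coordinates[OF assms(4) g]
      generator_coordinates[OF lie_bracket_in_se2[OF assms(3,4)] g] dual_lie_bracket[OF assms(3,4)]
      diff_divide_distrib[symmetric] minus_divide_left
    by (rule arg_cong2[where f = "(/)"]) (simp_all add: algebra_simps)
qed

text \<open>
  The terms of the area that contain the angular velocities and the vortex position are those of
  \<open>phi_vortex\<close> on the bracket with the opposite sign; the product of the two angular velocities
  drops out by antisymmetry.
\<close>
lemma vortex_contribution:
  assumes "p \<in> conf_space R" "\<xi> \<in> se2" "\<eta> \<in> se2"
  shows "phi_vortex \<Gamma> p (lie_bracket \<xi> \<eta>) +
     (\<Sum>i\<in>UNIV. \<Gamma> i * wedge (d_x i) (d_y i) (inf_generator \<xi> p) (inf_generator \<eta> p))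
   = (\<Sum>i\<in>UNIV. \<Gamma> i) * wedge dual_x dual_y \<xi> \<eta>"
proof -
  have g: "fst p \<in> SE2" using assms(1) by (auto simp: conf_space_def)
  show ?thesis
    unfolding phi_vortex_def dual_lie_bracket[OF assms(2,3)] wedge_def
      generator_coordinates[OF assms(2) g] generator_coordinates[OF assms(3) g]
      sum_distrib_right sum.distrib[symmetric] mult_zero_right add_0_left
    by (rule sum.cong) (simp_all add: d_x_def d_y_def algebra_simps)
qed

theorem theorem5p7:
  fixes R :: real and \<Gamma> :: "'n::finite \<Rightarrow> real"
  assumes "R > 0"
  shows "\<forall>\<xi>\<in>se2. \<forall>\<eta>\<in>se2. \<forall>p\<in>conf_space R.
           Sigma_cocycle R \<Gamma> \<xi> \<eta> p = - (\<Sum>i\<in>UNIV. \<Gamma> i) * wedge dual_x dual_y \<xi> \<eta>"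
proof (intro ballI)
  fix \<xi> \<eta> and p :: "'n conf"
  assume in_se2: "\<xi> \<in> se2" "\<eta> \<in> se2" and p: "p \<in> conf_space R"
  have "Sigma_cocycle R \<Gamma> \<xi> \<eta> p =
      - (phi_vortex \<Gamma> p (lie_bracket \<xi> \<eta>) +
     (\<Sum>i\<in>UNIV. \<Gamma> i * wedge (d_x i) (d_y i) (inf_generator \<xi> p) (inf_generator \<eta> p)))"
    by (simp add: Sigma_cocycle_def phi_def phi_stream_def beta_mu_def
        ext_deriv_Theta_on_generators[OF assms p in_se2] algebra_simps sum.distrib sum_negf sum_subtractf)
  then show "Sigma_cocycle R \<Gamma> \<xi> \<eta> p = - (\<Sum>i\<in>UNIV. \<Gamma> i) * wedge dual_x dual_y \<xi> \<eta>"
    by (simp add: vortex_contribution[OF p in_se2])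
qed

end
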